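(* Let $V$ be a finite set with $|V|>1$, let $(\mathsf Z_i : i\in V)$ be discrete random variables, and let $H$ be their entropy function. For every partition $\mathcal P\in\Pi'(V)$ define $$\varphi(\mathcal P)=\sum_{C\in\mathcal P}\frac{H(V)-H(C)}{|\mathcal P|-1}.$$ Then the minimum sum-rates in the asymptotic and non-asymptotic models are respectively $$R_{\mathrm{ACO}}(V)=\max_{\mathcal P\in\Pi'(V)}\varphi(\mathcal P),\qquad R_{\mathrm{NCO}}(V)=\Big\lceil \max_{\mathcal P\in\Pi'(V)}\varphi(\mathcal P)\Big\rceil .$$
   Context: For $X\subseteq V$, $H(X)$ denotes the Shannon entropy of the random vector $(\mathsf Z_i: i\in X)$, with $H(\emptyset)=0$, and $H(X|Y)=H(X\cup Y)-H(Y)$. For a rate vector $\mathbf r_V=(r_i:i\in V)\in\mathbb R^{|V|}$ write $r(X)=\sum_{i\in X}r_i$, $r(\emptyset)=0$. The set of achievable rate vectors (rates at which the users in $V$, user $i$ observing $\mathsf Z_i$, can broadcast so that all of them recover the whole source) is $$\mathscr R_{\mathrm{CO}}(V)=\{\mathbf r_V\in\mathbb R^{|V|}: r(X)\ge H(X|V\setminus X)\ \ \forall X\subsetneq V\}.$$ In the asymptotic model the rates may be real and the minimum sum-rate is $R_{\mathrm{ACO}}(V)=\min\{r(V):\mathbf r_V\in\mathscr R_{\mathrm{CO}}(V)\}$. In the non-asymptotic model the block length is finite, the rates are required to be integral and the minimum sum-rate is $R_{\mathrm{NCO}}(V)=\min\{r(V):\mathbf r_V\in\mathscr R_{\mathrm{CO}}(V)\cap\mathbb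 Z^{|V|}\}$. $\Pi(V)$ is the set of all partitions of $V$ into nonempty disjoint subsets, and $\Pi'(V)=\{\mathcal P\in\Pi(V):|\mathcal P|>1\}$.
   Formalization: The formula for the non-asymptotic minimum sum-rate is proved for sources whose entropy H(X) is an integer for every X ⊆ V, since it fails otherwise (two independent users uniform on 5 symbols, in bits: 6 versus 5); H(V) is assumed finite. *)

theory Defs
  imports "HOL-Probability.Information" "HOL-Library.Disjoint_Sets"
begin

text \<open>The random vector \<open>(Z i : i \<in> X)\<close>. Coordinates outside \<open>X\<close> are \<open>undefined\<close>, so for
  \<open>X = {}\<close> this is a constant.\<close>

definition subvector :: "('v \<Rightarrow> 'w \<Rightarrow> 'a) \<Rightarrow> 'v set \<Rightarrow> 'w \<Rightarrow> 'v \<Rightarrow> 'a" where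
  "subvector Z X = (\<lambda>\<omega>. \<lambda>i\<in>X. Z i \<omega>)"

text \<open>Shannon entropy to base \<open>b\<close>, with respect to counting measure on the range of the vector;
  this is \<open>entropy_Pow\<close> of \<open>information_space M b\<close>.\<close>

definition source_entropy :: "'w measure \<Rightarrow> real \<Rightarrow> ('v \<Rightarrow> 'w \<Rightarrow> 'a) \<Rightarrow> 'v set \<Rightarrow> real" where
  "source_entropy M b Z X =
     prob_space.entropy M b (count_space (subvector Z X ` space M)) (subvector Z X)"

text \<open>A discrete source: each \<open>Z i\<close> takes countably many values and \<open>H(V)\<close> is finite. Finiteness
  has to be asked for, since the value of \<open>entropy\<close> is a Bochner integral, which is \<open>0\<close> when the
  integral diverges.\<close>

definition discrete_source :: "'w measure \<Rightarrow> real \<Rightarrow> ('v \<Rightarrow> 'w \<Rightarrow> 'a) \<Rightarrow> 'v set \<Rightarrow> bool" where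
  "discrete_source M b Z V \<longleftrightarrow>
     (\<forall>i\<in>V. countable (Z i ` space M) \<and> Z i \<in> M \<rightarrow>\<^sub>M count_space UNIV) \<and>
     (\<exists>f. information_space.finite_entropy M b
            (count_space (subvector Z V ` space M)) (subvector Z V) f)"

definition cond_ent :: "('v set \<Rightarrow> real) \<Rightarrow> 'v set \<Rightarrow> 'v set \<Rightarrow> real" where
  "cond_ent H X Y = H (X \<union> Y) - H Y"

text \<open>A rate vector indexed by \<open>V\<close> is a function that is \<open>undefined\<close> off \<open>V\<close>.\<close>

definition R_CO :: "('v set \<Rightarrow> real) \<Rightarrow> 'v set \<Rightarrow> ('v \<Rightarrow> real) set" where
  "R_CO H V = {r \<in> V \<rightarrow>\<^sub>E UNIV. \<forall>X. X \<subset> V \<longrightarrow> sum r X \<ge> cond_ent H X (V - X)}"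

definition R_CO_int :: "('v set \<Rightarrow> real) \<Rightarrow> 'v set \<Rightarrow> ('v \<Rightarrow> real) set" where
  "R_CO_int H V = R_CO H V \<inter> (V \<rightarrow>\<^sub>E \<int>)"

text \<open>\<open>LEAST\<close> on the reals is meaningful only where the minimum is attained.\<close>

definition R_ACO :: "('v set \<Rightarrow> real) \<Rightarrow> 'v set \<Rightarrow> real" where
  "R_ACO H V = (LEAST s. s \<in> (\<lambda>r. sum r V) ` R_CO H V)"

definition R_NCO :: "('v set \<Rightarrow> real) \<Rightarrow> 'v set \<Rightarrow> real" where
  "R_NCO H V = (LEAST s. s \<in> (\<lambda>r. sum r V) ` R_CO_int H V)"

definition proper_partitions :: "'v set \<Rightarrow> 'v set set set" where
  "proper_partitions V = {P. partition_on V P \<and> card P > 1}"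

definition phi :: "('v set \<Rightarrow> real) \<Rightarrow> 'v set \<Rightarrow> 'v set set \<Rightarrow> real" where
  "phi H V P = (\<Sum>C\<in>P. (H V - H C) / (real (card P) - 1))"

text \<open>The standing assumption of the non-asymptotic model (finite linear sources and the like). It
  cannot be dropped from the formula for \<open>R_NCO\<close>: for two independent users with
  \<open>H {1} = H {2} = 1/2\<close> and \<open>H {1,2} = 1\<close>, integrality forces both rates to be at least \<open>1\<close>,
  so that \<open>R_NCO = 2\<close>, whereas \<open>phi\<close> of the only proper partition is \<open>1\<close>.\<close>

definition integral_entropy :: "('v set \<Rightarrow> real) \<Rightarrow> 'v set \<Rightarrow> bool" where
  "integral_entropy H V \<longleftrightarrow> (\<forall>X. X \<subseteq> V \<longrightarrow> H X \<in> \<int>)"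

end

theory Submission
  imports Defs
begin

text \<open>Fix a target sum-rate \<open>a\<close>. A vector \<open>r\<close> with \<open>r(V) = a\<close> is achievable iff
  \<open>r(Y) \<le> h(Y) := H(Y) + a - H(V)\<close> for all nonempty \<open>Y \<subseteq> V\<close>, and \<open>h\<close> is submodular on intersecting
  pairs. Raising the coordinates one after the other as far as these constraints permit ends in a
  vector for which every user lies in a tight set; unions of intersecting tight sets are tight, so
  the maximal tight sets partition \<open>V\<close> and \<open>r(V)\<close> is the sum of \<open>h\<close> over this partition. That sum is
  at least \<open>a\<close> exactly when \<open>\<phi>\<close> of the partition is at most \<open>a\<close>. All increments are integers when
  \<open>H\<close> and \<open>a\<close> are integral, whence the ceiling.\<close>

section \<open>Submodularity of the source entropy\<close>

text \<open>Pointwise self-information of \<open>X\<close>. It depends only on the partition of the sample space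
  into level sets of \<open>X\<close>, so random vectors that determine each other have the same one.\<close>

definition (in information_space) self_info :: "('a \<Rightarrow> 'x) \<Rightarrow> 'a \<Rightarrow> real" where
  "self_info X \<omega> = - log b (prob {\<omega>' \<in> space M. X \<omega>' = X \<omega>})"

context information_space
begin

section \<open>Entropy of countably-valued variables as expected self-information\<close>

lemma distributed_countable:
  assumes "countable A" "random_variable (count_space A) X"
  shows "distributed M (count_space A) X (\<lambda>x. prob {\<omega> \<in> space M. X \<omega> = x})"
  unfolding distributed_def
proof (intro conjI)
  show "distr M (count_space A) X = density (count_space A) (\<lambda>x. prob {\<omega> \<in> space M. X \<omega> = x})"
  proof (rule measure_eqI_countable[where A = A])
    fix a assume "a \<in> A"
    moreover have "X -` {a} \<inter> space M = {\<omega> \<in> space M. X \<omega> = a}" by auto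
    ultimately show "emeasure (distr M (count_space A) X) {a} =
        emeasure (density (count_space A) (\<lambda>x. prob {\<omega> \<in> space M. X \<omega> = x})) {a}"
      using assms by (simp add: emeasure_distr emeasure_density emeasure_eq_measure
          nn_integral_indicator_singleton)
  qed (use assms in auto)
qed (use assms in auto)

text \<open>Densities are unique almost everywhere, and counting measure has no nonempty null set,
  so the equality holds at every point. Nonnegativity of \<open>f x\<close> allows passing back from
  \<open>ennreal\<close>, which truncates negative reals.\<close>

lemma distributed_countable_unique:
  fixes f :: "'x \<Rightarrow> real"
  assumes "countable A" "distributed M (count_space A) X f" "x \<in> A" "0 \<le> f x"
  shows "f x = prob {\<omega> \<in> space M. X \<omega> = x}"
proof -
  have X: "random_variable (count_space A) X" using assms(2) by (rule distributed_measurable)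
  have "AE y in count_space A. ennreal (f y) = ennreal (prob {\<omega> \<in> space M. X \<omega> = y})"
    using assms(2) distributed_countable[OF assms(1) X] by (rule distributed_unique)
  then have "ennreal (f x) = ennreal (prob {\<omega> \<in> space M. X \<omega> = x})"
    using assms(3) by (simp add: AE_count_space)
  then show ?thesis using assms(4) by (subst (asm) ennreal_inj) auto
qed

lemma self_info_measurable:
  assumes "countable A" "random_variable (count_space A) X"
  shows "self_info X \<in> borel_measurable M"
proof -
  have "(\<lambda>x. - log b (prob {\<omega> \<in> space M. X \<omega> = x})) \<circ> X \<in> borel_measurable M"
    using assms(2) by (rule measurable_comp) simp
  moreover have "(\<lambda>x. - log b (prob {\<omega> \<in> space M. X \<omega> = x})) \<circ> X = self_info X"
    by (simp add: fun_eq_iff self_info_def)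
  ultimately show ?thesis by simp
qed

text \<open>Change of variables from the law of \<open>X\<close> to the sample space. All entropies
  become integrals over the same \<open>M\<close>, so random vectors with different value spaces can
  be compared pointwise.\<close>

lemma entropy_eq_self_info:
  assumes "countable A" "random_variable (count_space A) X"
  shows "entropy b (count_space A) X = (\<integral>\<omega>. self_info X \<omega> \<partial>M)"
proof -
  let ?p = "\<lambda>x. prob {\<omega> \<in> space M. X \<omega> = x}"
  note D = distributed_countable[OF assms]
  have "entropy b (count_space A) X = - (\<integral>x. ?p x * log b (?p x) \<partial>count_space A)"
    by (rule entropy_distr[OF D]) auto
  also have "(\<integral>x. ?p x * log b (?p x) \<partial>count_space A) = (\<integral>\<omega>. log b (?p (X \<omega>)) \<partial>M)"
    by (rule distributed_integral[OF D]) auto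
  finally show ?thesis by (simp add: self_info_def)
qed

lemma finite_entropy_iff_self_info:
  assumes "countable A" "random_variable (count_space A) X"
  shows "finite_entropy (count_space A) X (\<lambda>x. prob {\<omega> \<in> space M. X \<omega> = x}) \<longleftrightarrow>
    integrable M (self_info X)"
proof -
  note D = distributed_countable[OF assms]
  have "self_info X = (\<lambda>\<omega>. - log b (prob {\<omega>' \<in> space M. X \<omega>' = X \<omega>}))"
    by (auto simp: self_info_def)
  then show ?thesis
    using D distributed_integrable[OF D, of "\<lambda>x. log b (prob {\<omega> \<in> space M. X \<omega> = x})"]
    by (auto simp: finite_entropy_def)
qed

text \<open>The finiteness clause of \<open>discrete_source\<close> only provides some density
  \<open>f\<close>; by uniqueness it is the probability mass function.\<close>

lemma finite_entropy_imp_self_info: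
  assumes "countable A" "finite_entropy (count_space A) X f"
  shows "integrable M (self_info X)"
proof -
  let ?p = "\<lambda>x. prob {\<omega> \<in> space M. X \<omega> = x}"
  have D: "distributed M (count_space A) X f" using assms(2) by (rule finite_entropy_distributed)
  then have X: "random_variable (count_space A) X" by (rule distributed_measurable)
  have "f x = ?p x" if "x \<in> A" for x
    using assms that by (intro distributed_countable_unique[OF assms(1) D]) (auto simp: finite_entropy_def)
  then have "integrable (count_space A) (\<lambda>x. f x * log b (f x)) \<longleftrightarrow>
      integrable (count_space A) (\<lambda>x. ?p x * log b (?p x))"
    by (intro Bochner_Integration.integrable_cong) auto
  then have "integrable (count_space A) (\<lambda>x. ?p x * log b (?p x))"
    using assms(2) by (auto simp: finite_entropy_def)
  then have "finite_entropy (count_space A) X ?p"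
    using distributed_countable[OF assms(1) X] by (simp add: finite_entropy_def)
  then show ?thesis using finite_entropy_iff_self_info[OF assms(1) X] by simp
qed

text \<open>The law of \<open>X\<close> has the mass function as density, so it does not charge the
  points where that function vanishes. Outside this null set logarithms are monotone and split over
  products and quotients.\<close>

lemma AE_atom_pos:
  assumes "countable A" "random_variable (count_space A) X"
  shows "AE \<omega> in M. 0 < prob {\<omega>' \<in> space M. X \<omega>' = X \<omega>}"
proof -
  let ?p = "\<lambda>x. prob {\<omega> \<in> space M. X \<omega> = x}"
  have "AE x in density (count_space A) (\<lambda>x. ennreal (?p x)). 0 < ?p x"
    by (subst AE_density) (auto simp: AE_count_space)
  then have "AE x in distr M (count_space A) X. 0 < ?p x"
    by (subst distributed_distr_eq_density[OF distributed_countable[OF assms]])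
  then show ?thesis using assms(2) by (subst (asm) AE_distr_iff) auto
qed

text \<open>If \<open>Y\<close> determines \<open>X\<close>, each level set of \<open>Y\<close> lies
  in one of \<open>X\<close>. Hence almost surely the self-information of \<open>X\<close> lies
  between 0 and that of \<open>Y\<close>, and domination gives integrability.\<close>

lemma integrable_self_info_mono:
  assumes "countable A" "random_variable (count_space A) X"
    and "countable B" "random_variable (count_space B) Y"
    and Y: "integrable M (self_info Y)"
    and coarser: "\<And>\<omega> \<omega>'. \<omega> \<in> space M \<Longrightarrow> \<omega>' \<in> space M \<Longrightarrow> Y \<omega> = Y \<omega>' \<Longrightarrow> X \<omega> = X \<omega>'"
  shows "integrable M (self_info X)"
proof (rule Bochner_Integration.integrable_bound[OF Y self_info_measurable[OF assms(1,2)]])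
  show "AE \<omega> in M. norm (self_info X \<omega>) \<le> norm (self_info Y \<omega>)"
    using AE_atom_pos[OF assms(3,4)] AE_space
  proof eventually_elim
    case (elim \<omega>)
    let ?x = "prob {\<omega>' \<in> space M. X \<omega>' = X \<omega>}" and ?y = "prob {\<omega>' \<in> space M. Y \<omega>' = Y \<omega>}"
    have "X -` {X \<omega>} \<inter> space M \<in> events"
      using measurable_sets[OF assms(2), of "{X \<omega>}"] measurable_space[OF assms(2) elim(2)] by simp
    moreover have "X -` {X \<omega>} \<inter> space M = {\<omega>' \<in> space M. X \<omega>' = X \<omega>}" by auto
    moreover have "{\<omega>' \<in> space M. Y \<omega>' = Y \<omega>} \<subseteq> {\<omega>' \<in> space M. X \<omega>' = X \<omega>}"
      using coarser[OF _ elim(2)] by blast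
    ultimately have "?y \<le> ?x" by (intro finite_measure_mono) simp_all
    then have "log b ?y \<le> log b ?x" "log b ?x \<le> 0" "log b ?y \<le> 0"
      using elim(1) b_gt_1 by (auto simp: log_le_zero_cancel_iff)
    then show ?case by (simp add: self_info_def)
  qed
qed

section \<open>Submodularity from nonnegative conditional mutual information\<close>

lemma random_variable_Pair_countable:
  assumes "countable A" "random_variable (count_space A) X"
    and "countable B" "random_variable (count_space B) Y"
  shows "random_variable (count_space (A \<times> B)) (\<lambda>\<omega>. (X \<omega>, Y \<omega>))"
  using measurable_Pair[OF assms(2,4)] pair_measure_countable[OF assms(1,3)] by simp

text \<open>This is I(X;Y|Z) \<ge> 0, pulled back to the sample space and expanded into four
  entropies.\<close>

lemma self_info_submodular:
  fixes X :: "'a \<Rightarrow> 'x" and Y :: "'a \<Rightarrow> 'y" and Z :: "'a \<Rightarrow> 'z"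
  assumes A: "countable A" "random_variable (count_space A) X"
    and B: "countable B" "random_variable (count_space B) Y"
    and C: "countable C" "random_variable (count_space C) Z"
    and fin: "integrable M (self_info (\<lambda>\<omega>. (X \<omega>, Y \<omega>, Z \<omega>)))"
  shows "(\<integral>\<omega>. self_info (\<lambda>\<omega>. (X \<omega>, Y \<omega>, Z \<omega>)) \<omega> \<partial>M) + (\<integral>\<omega>. self_info Z \<omega> \<partial>M)
    \<le> (\<integral>\<omega>. self_info (\<lambda>\<omega>. (X \<omega>, Z \<omega>)) \<omega> \<partial>M) + (\<integral>\<omega>. self_info (\<lambda>\<omega>. (Y \<omega>, Z \<omega>)) \<omega> \<partial>M)"
proof -
  let ?xyz = "\<lambda>\<omega>. (X \<omega>, Y \<omega>, Z \<omega>)"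
  let ?xz = "\<lambda>\<omega>. (X \<omega>, Z \<omega>)"
  let ?yz = "\<lambda>\<omega>. (Y \<omega>, Z \<omega>)"
  let ?S = "count_space A" and ?T = "count_space B" and ?P = "count_space C"
  have c: "countable (A \<times> C)" "countable (B \<times> C)" "countable (A \<times> B \<times> C)"
    using A(1) B(1) C(1) by auto
  note XZ = random_variable_Pair_countable[OF A C]
  note YZ = random_variable_Pair_countable[OF B C]
  note XYZ = random_variable_Pair_countable[OF A c(2) YZ]
  have ps: "?S \<Otimes>\<^sub>M ?P = count_space (A \<times> C)" "?T \<Otimes>\<^sub>M ?P = count_space (B \<times> C)"
    "?S \<Otimes>\<^sub>M count_space (B \<times> C) = count_space (A \<times> B \<times> C)"
    using A(1) B(1) C(1) c by (simp_all add: pair_measure_countable)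
  \<comment> \<open>The triple determines each of its marginals, so its finite entropy passes to all
    of them.\<close>
  have iX: "integrable M (self_info X)"
    by (rule integrable_self_info_mono[OF A c(3) XYZ fin]) auto
  have iZ: "integrable M (self_info Z)"
    by (rule integrable_self_info_mono[OF C c(3) XYZ fin]) auto
  have iXZ: "integrable M (self_info ?xz)"
    by (rule integrable_self_info_mono[OF c(1) XZ c(3) XYZ fin]) auto
  have iYZ: "integrable M (self_info ?yz)"
    by (rule integrable_self_info_mono[OF c(2) YZ c(3) XYZ fin]) auto
  define pz where "pz z = prob {\<omega> \<in> space M. Z \<omega> = z}" for z
  define pxz where "pxz u = prob {\<omega> \<in> space M. ?xz \<omega> = u}" for u
  define pyz where "pyz u = prob {\<omega> \<in> space M. ?yz \<omega> = u}" for u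
  define pxyz where "pxyz u = prob {\<omega> \<in> space M. ?xyz \<omega> = u}" for u
  \<comment> \<open>The integrand of I(X;Y|Z), namely log of p(x,y,z) p(z) / (p(x,z) p(y,z)),
    arranged as in the formula for conditional mutual information used below.\<close>
  define g where "g = (\<lambda>(x, y, z). log b (pxyz (x, y, z) / (pxz (x, z) * (pyz (y, z) / pz z))))"
  have sig: "sigma_finite_measure ?S" "sigma_finite_measure ?T" "sigma_finite_measure ?P"
    using A(1) B(1) C(1) by (auto intro: sigma_finite_measure_count_space_countable)
  have F: "finite_entropy ?S X (\<lambda>x. prob {\<omega> \<in> space M. X \<omega> = x})"
    "finite_entropy ?P Z pz"
    "finite_entropy (?T \<Otimes>\<^sub>M ?P) ?yz pyz"
    "finite_entropy (?S \<Otimes>\<^sub>M ?P) ?xz pxz"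
    "finite_entropy (?S \<Otimes>\<^sub>M ?T \<Otimes>\<^sub>M ?P) ?xyz pxyz"
    unfolding ps pz_def pxz_def pyz_def pxyz_def
    using finite_entropy_iff_self_info[OF A] finite_entropy_iff_self_info[OF C]
      finite_entropy_iff_self_info[OF c(1) XZ] finite_entropy_iff_self_info[OF c(2) YZ]
      finite_entropy_iff_self_info[OF c(3) XYZ] iX iZ iXZ iYZ fin
    by simp_all
  have "0 \<le> (\<integral>(x, y, z). pxyz (x, y, z) * log b (pxyz (x, y, z) / (pxz (x, z) * (pyz (y, z) / pz z)))
      \<partial>(?S \<Otimes>\<^sub>M ?T \<Otimes>\<^sub>M ?P))"
    using conditional_mutual_information_generic_nonneg'[OF sig F]
      conditional_mutual_information_generic_eq'[OF sig F] by simp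
  also have "\<dots> = (\<integral>u. pxyz u * g u \<partial>count_space (A \<times> B \<times> C))"
    unfolding ps by (intro Bochner_Integration.integral_cong) (auto simp: g_def)
  also have "\<dots> = (\<integral>\<omega>. g (?xyz \<omega>) \<partial>M)"
    using F(5) unfolding ps by (intro distributed_integral) (auto simp: finite_entropy_def)
  also have "\<dots> = (\<integral>\<omega>. self_info ?xz \<omega> + self_info ?yz \<omega> - self_info ?xyz \<omega> - self_info Z \<omega> \<partial>M)"
  proof (rule integral_cong_AE)
    show "(\<lambda>\<omega>. g (?xyz \<omega>)) \<in> borel_measurable M"
      by (rule measurable_compose[OF XYZ]) simp
    show "(\<lambda>\<omega>. self_info ?xz \<omega> + self_info ?yz \<omega> - self_info ?xyz \<omega> - self_info Z \<omega>) \<in> borel_measurable M"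
      using iXZ iYZ iZ fin by (intro borel_measurable_diff borel_measurable_add) auto
    \<comment> \<open>The logarithm splits into four terms only where all four probabilities are
      positive, which is almost everywhere.\<close>
    show "AE \<omega> in M. g (?xyz \<omega>) = self_info ?xz \<omega> + self_info ?yz \<omega> - self_info ?xyz \<omega> - self_info Z \<omega>"
      using AE_atom_pos[OF C] AE_atom_pos[OF c(1) XZ] AE_atom_pos[OF c(2) YZ] AE_atom_pos[OF c(3) XYZ]
    proof eventually_elim
      case (elim \<omega>)
      then have "0 < pz (Z \<omega>)" "0 < pxz (?xz \<omega>)" "0 < pyz (?yz \<omega>)" "0 < pxyz (?xyz \<omega>)"
        by (simp_all add: pz_def pxz_def pyz_def pxyz_def)
      moreover have "self_info Z \<omega> = - log b (pz (Z \<omega>))" "self_info ?xz \<omega> = - log b (pxz (?xz \<omega>))"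
        "self_info ?yz \<omega> = - log b (pyz (?yz \<omega>))" "self_info ?xyz \<omega> = - log b (pxyz (?xyz \<omega>))"
        by (simp_all add: self_info_def pz_def pxz_def pyz_def pxyz_def)
      ultimately show ?case
        by (simp add: g_def log_divide_pos log_mult_pos)
    qed
  qed
  also have "\<dots> = (\<integral>\<omega>. self_info ?xz \<omega> \<partial>M) + (\<integral>\<omega>. self_info ?yz \<omega> \<partial>M)
      - (\<integral>\<omega>. self_info ?xyz \<omega> \<partial>M) - (\<integral>\<omega>. self_info Z \<omega> \<partial>M)"
    using iXZ iYZ iZ fin by simp
  finally show ?thesis by simp
qed

section \<open>Random vectors indexed by sets of users\<close>

lemma subvector_eq_iff:
  "subvector Z X \<omega> = subvector Z X \<omega>' \<longleftrightarrow> (\<forall>i\<in>X. Z i \<omega> = Z i \<omega>')"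
proof
  assume "subvector Z X \<omega> = subvector Z X \<omega>'"
  then have "subvector Z X \<omega> i = subvector Z X \<omega>' i" for i by simp
  then show "\<forall>i\<in>X. Z i \<omega> = Z i \<omega>'" unfolding subvector_def by (metis restrict_apply')
next
  assume "\<forall>i\<in>X. Z i \<omega> = Z i \<omega>'"
  then show "subvector Z X \<omega> = subvector Z X \<omega>'"
    unfolding subvector_def by (intro restrict_ext) blast
qed

text \<open>The range sits in a finite product of countable sets, and each level set is a finite
  intersection of coordinate events.\<close>

lemma subvector_countable:
  assumes "finite X" "\<And>i. i \<in> X \<Longrightarrow> countable (Z i ` space M)"
    and meas: "\<And>i. i \<in> X \<Longrightarrow> Z i \<in> M \<rightarrow>\<^sub>M count_space UNIV"
  shows "countable (subvector Z X ` space M)"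
    and "random_variable (count_space (subvector Z X ` space M)) (subvector Z X)"
proof -
  have "subvector Z X ` space M \<subseteq> (\<Pi>\<^sub>E i\<in>X. Z i ` space M)" by (auto simp: subvector_def)
  then show c: "countable (subvector Z X ` space M)"
    using assms(1,2) by (rule countable_subset[OF _ countable_PiE])
  have "subvector Z X -` {a} \<inter> space M \<in> events" if a: "a \<in> subvector Z X ` space M" for a
  proof -
    obtain \<omega>' where "a = subvector Z X \<omega>'" using a by blast
    then have "subvector Z X -` {a} \<inter> space M = {\<omega> \<in> space M. \<forall>i\<in>X. Z i \<omega> = a i}"
      by (auto simp: subvector_eq_iff) (simp_all add: subvector_def)
    moreover have "{\<omega> \<in> space M. Z i \<omega> = a i} \<in> events" if "i \<in> X" for i
    proof -
      have "Z i -` {a i} \<inter> space M \<in> events" using meas[OF that] by (rule measurable_sets) simp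
      moreover have "Z i -` {a i} \<inter> space M = {\<omega> \<in> space M. Z i \<omega> = a i}" by auto
      ultimately show ?thesis by simp
    qed
    ultimately show ?thesis using assms(1) by (simp add: sets.sets_Collect_finite_All')
  qed
  then show "random_variable (count_space (subvector Z X ` space M)) (subvector Z X)"
    using c by (subst measurable_count_space_eq_countable) auto
qed

text \<open>Condition the vectors of \<open>X\<close> and \<open>Y\<close> on their common part, the
  vector of \<open>X \<inter> Y\<close>; for disjoint sets this is a constant.\<close>

lemma source_entropy_submodular:
  assumes "finite V" "discrete_source M b Z V" "X \<subseteq> V" "Y \<subseteq> V"
  shows "source_entropy M b Z (X \<union> Y) + source_entropy M b Z (X \<inter> Y)
    \<le> source_entropy M b Z X + source_entropy M b Z Y"
proof -
  let ?s = "subvector Z"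
  have rv: "countable (?s W ` space M)" "random_variable (count_space (?s W ` space M)) (?s W)"
    if "W \<subseteq> V" for W
    using assms(2) that finite_subset[OF that assms(1)]
    by (auto simp: discrete_source_def intro!: subvector_countable)
  have H: "source_entropy M b Z W = (\<integral>\<omega>. self_info (?s W) \<omega> \<partial>M)" if "W \<subseteq> V" for W
    unfolding source_entropy_def using rv[OF that] by (rule entropy_eq_self_info)
  have "integrable M (self_info (?s V))"
    using assms(2) finite_entropy_imp_self_info[OF rv(1)[of V]] by (auto simp: discrete_source_def)
  have U: "X \<union> Y \<subseteq> V" using assms(3,4) by auto
  have int: "integrable M (self_info (?s (X \<union> Y)))"
    using U by (intro integrable_self_info_mono[OF rv[OF U] rv[OF subset_refl] \<open>integrable M (self_info (?s V))\<close>])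
      (auto simp: subvector_eq_iff)
  \<comment> \<open>The tuples repeat coordinates: the triple has the level sets of the vector of
    \<open>X \<union> Y\<close>, and in the two pairs below the second component is a function of
    the first. Equal level sets mean equal self-information.\<close>
  have XYZ: "self_info (\<lambda>\<omega>. (?s X \<omega>, ?s Y \<omega>, ?s (X \<inter> Y) \<omega>)) = self_info (?s (X \<union> Y))"
    unfolding self_info_def by (intro ext arg_cong[of _ _ "\<lambda>A. - log b (prob A)"]) (auto simp: subvector_eq_iff)
  have XZ: "self_info (\<lambda>\<omega>. (?s X \<omega>, ?s (X \<inter> Y) \<omega>)) = self_info (?s X)"
    unfolding self_info_def by (intro ext arg_cong[of _ _ "\<lambda>A. - log b (prob A)"]) (auto simp: subvector_eq_iff)
  have YZ: "self_info (\<lambda>\<omega>. (?s Y \<omega>, ?s (X \<inter> Y) \<omega>)) = self_info (?s Y)"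
    unfolding self_info_def by (intro ext arg_cong[of _ _ "\<lambda>A. - log b (prob A)"]) (auto simp: subvector_eq_iff)
  have I: "X \<inter> Y \<subseteq> V" using assms(3) by auto
  show ?thesis
    using self_info_submodular[OF rv[OF assms(3)] rv[OF assms(4)] rv[OF I]] int
    by (simp add: XYZ XZ YZ H assms I U)
qed

end

section \<open>Tight vectors and optimal sum-rates\<close>

text \<open>Greedy raising, by induction on the set \<open>W\<close> of users already lying in a
  tight set, while feasibility is kept for all of \<open>V\<close>. Integrality is carried along
  because the start and every increment are integral when \<open>h\<close> is.\<close>

lemma exists_tight_vector:
  fixes h :: "'v set \<Rightarrow> real"
  assumes "finite V"
  shows "\<exists>r. (\<forall>Y. Y \<subseteq> V \<longrightarrow> Y \<noteq> {} \<longrightarrow> sum r Y \<le> h Y) \<and>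
             (\<forall>i\<in>V. \<exists>Y. i \<in> Y \<and> Y \<subseteq> V \<and> sum r Y = h Y) \<and>
             ((\<forall>Y. Y \<subseteq> V \<longrightarrow> h Y \<in> \<int>) \<longrightarrow> range r \<subseteq> \<int>)"
proof -
  have "\<exists>r. (\<forall>Y. Y \<subseteq> V \<longrightarrow> Y \<noteq> {} \<longrightarrow> sum r Y \<le> h Y) \<and>
             (\<forall>i\<in>W. \<exists>Y. i \<in> Y \<and> Y \<subseteq> V \<and> sum r Y = h Y) \<and>
             ((\<forall>Y. Y \<subseteq> V \<longrightarrow> h Y \<in> \<int>) \<longrightarrow> range r \<subseteq> \<int>)" if "W \<subseteq> V" for W
    using finite_subset[OF that assms] that
  proof (induction W rule: finite_induct)
    case empty
    \<comment> \<open>An integer bounding every \<bar>h(Y)\<bar>: the constant vector -N is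
      feasible, since a nonempty \<open>Y\<close> sums to at most -N. Rounding up makes the start
      integral for every \<open>h\<close>.\<close>
    define N where "N = (\<Sum>Y\<in>Pow V. of_int \<lceil>\<bar>h Y\<bar>\<rceil> :: real)"
    have "(\<Sum>i\<in>Y. - N) \<le> h Y" if "Y \<subseteq> V" "Y \<noteq> {}" for Y
    proof -
      have "\<bar>h Y\<bar> \<le> of_int \<lceil>\<bar>h Y\<bar>\<rceil>" by simp
      also have "\<dots> \<le> N"
        unfolding N_def using assms that
        by (intro member_le_sum) (auto intro: order_trans[of _ "\<bar>_\<bar>"])
      finally have N: "\<bar>h Y\<bar> \<le> N" .
      have "1 \<le> real (card Y)"
        using that assms by (simp add: Suc_leI card_gt_0_iff finite_subset)
      then have "1 * N \<le> real (card Y) * N"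
        using N by (intro mult_right_mono) auto
      then show ?thesis using N by simp
    qed
    moreover have "- N \<in> \<int>" by (auto simp: N_def)
    ultimately show ?case by (intro exI[of _ "\<lambda>_. - N"]) auto
  next
    case (insert i W)
    then have "W \<subseteq> V" "i \<in> V" by auto
    with insert.IH obtain r where feas: "\<And>Y. Y \<subseteq> V \<Longrightarrow> Y \<noteq> {} \<Longrightarrow> sum r Y \<le> h Y"
      and tight: "\<And>j. j \<in> W \<Longrightarrow> \<exists>Y. j \<in> Y \<and> Y \<subseteq> V \<and> sum r Y = h Y"
      and int: "(\<forall>Y. Y \<subseteq> V \<longrightarrow> h Y \<in> \<int>) \<longrightarrow> range r \<subseteq> \<int>"
      by metis
    let ?S = "{Y. i \<in> Y \<and> Y \<subseteq> V}"
    let ?D = "(\<lambda>Y. h Y - sum r Y) ` ?S"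
    \<comment> \<open>The least slack among sets through \<open>i\<close>, hence the largest
      feasible increase of coordinate \<open>i\<close>; a minimising set becomes tight.\<close>
    define m where "m = Min ?D"
    have "finite ?S" using assms by (auto intro: finite_subset[of _ "Pow V"])
    then have fin: "finite ?D" by simp
    have "V \<in> ?S" using \<open>i \<in> V\<close> by auto
    then have ne: "?D \<noteq> {}" by blast
    have m_le: "m \<le> h Y - sum r Y" if "i \<in> Y" "Y \<subseteq> V" for Y
      unfolding m_def using fin that by (intro Min_le) auto
    have "m \<in> ?D" unfolding m_def using fin ne by (rule Min_in)
    then obtain Y0 where Y0: "i \<in> Y0" "Y0 \<subseteq> V" "m = h Y0 - sum r Y0" by auto
    have m0: "0 \<le> m" using feas[of Y0] Y0 by auto
    define r' where "r' = r(i := r i + m)"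
    have sum1: "sum r' Y = sum r Y + m" if "i \<in> Y" "Y \<subseteq> V" for Y
    proof -
      have "finite Y" using that assms finite_subset by blast
      then have "sum r' Y = r' i + sum r' (Y - {i})" "sum r Y = r i + sum r (Y - {i})"
        using that by (auto intro: sum.remove)
      moreover have "sum r' (Y - {i}) = sum r (Y - {i})"
        by (intro sum.cong) (auto simp: r'_def)
      ultimately show ?thesis by (simp add: r'_def)
    qed
    have sum2: "sum r' Y = sum r Y" if "i \<notin> Y" for Y
      using that by (intro sum.cong) (auto simp: r'_def)
    have "sum r' Y \<le> h Y" if "Y \<subseteq> V" "Y \<noteq> {}" for Y
      using feas[OF that] sum1[of Y] sum2[of Y] m_le[of Y] that by (cases "i \<in> Y") auto
    moreover have "\<exists>Y. j \<in> Y \<and> Y \<subseteq> V \<and> sum r' Y = h Y" if "j \<in> insert i W" for j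
    proof (cases "j = i")
      case True
      then show ?thesis using Y0 sum1[of Y0] by auto
    next
      case False
      then obtain Y where Y: "j \<in> Y" "Y \<subseteq> V" "sum r Y = h Y" using tight \<open>j \<in> insert i W\<close> by auto
      \<comment> \<open>A tight set through \<open>i\<close> forces \<open>m = 0\<close>, so it stays tight.\<close>
      then have "sum r' Y = h Y"
        using sum1[of Y] sum2[of Y] m_le[of Y] m0 by (cases "i \<in> Y") auto
      then show ?thesis using Y by blast
    qed
    moreover have "range r' \<subseteq> \<int>" if "\<forall>Y. Y \<subseteq> V \<longrightarrow> h Y \<in> \<int>"
    proof -
      have r: "r x \<in> \<int>" for x using int that by auto
      then have "m \<in> \<int>" unfolding Y0(3) using that Y0(2) by (intro Ints_diff Ints_sum) auto
      then show ?thesis using r by (auto simp: r'_def)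
    qed
    ultimately show ?case
      by (intro exI[of _ r'] conjI allI ballI impI)
  qed
  from this[of V] show ?thesis by simp
qed

text \<open>Uncrossing: since \<open>sum r\<close> is modular and \<open>h\<close> submodular on
  intersecting pairs, two distinct maximal tight sets cannot meet.\<close>

lemma tight_sets_partition:
  fixes h :: "'v set \<Rightarrow> real"
  assumes "finite V"
    and submod: "\<And>X Y. X \<subseteq> V \<Longrightarrow> Y \<subseteq> V \<Longrightarrow> X \<inter> Y \<noteq> {} \<Longrightarrow> h (X \<union> Y) + h (X \<inter> Y) \<le> h X + h Y"
    and feas: "\<And>Y. Y \<subseteq> V \<Longrightarrow> Y \<noteq> {} \<Longrightarrow> sum r Y \<le> h Y"
    and tight: "\<And>i. i \<in> V \<Longrightarrow> \<exists>Y. i \<in> Y \<and> Y \<subseteq> V \<and> sum r Y = h Y"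
  obtains P where "partition_on V P" and "sum r V = sum h P"
proof
  define T where "T = {Y. Y \<noteq> {} \<and> Y \<subseteq> V \<and> sum r Y = h Y}"
  define P where "P = {Y \<in> T. \<forall>Z\<in>T. Y \<subseteq> Z \<longrightarrow> Y = Z}"
  have "finite T" using assms(1) by (auto simp: T_def intro: finite_subset[of _ "Pow V"])
  have un: "X \<union> Y \<in> T" if "X \<in> T" "Y \<in> T" "X \<inter> Y \<noteq> {}" for X Y
  proof -
    have XY: "X \<subseteq> V" "Y \<subseteq> V" "finite X" "finite Y" "sum r X = h X" "sum r Y = h Y"
      using that assms(1) finite_subset by (auto simp: T_def)
    \<comment> \<open>Feasibility at the intersection requires it to be nonempty. The two upper
      bounds add up to at most h(X) + h(Y), which the modular sum attains, so both are
      equalities.\<close>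
    have "sum r (X \<union> Y) \<le> h (X \<union> Y)" "sum r (X \<inter> Y) \<le> h (X \<inter> Y)"
      using XY that(3) by (auto intro!: feas)
    moreover have "sum r (X \<union> Y) + sum r (X \<inter> Y) = sum r X + sum r Y"
      using XY by (intro sum.union_inter)
    ultimately have "sum r (X \<union> Y) = h (X \<union> Y)"
      using submod[of X Y] XY that(3) by linarith
    then show ?thesis using that by (auto simp: T_def)
  qed
  have disj: "disjoint P"
    unfolding disjoint_def
  proof (intro ballI impI)
    fix X Y assume XY: "X \<in> P" "Y \<in> P" "X \<noteq> Y"
    show "X \<inter> Y = {}"
    proof (rule ccontr)
      assume "X \<inter> Y \<noteq> {}"
      then have "X \<union> Y \<in> T" using XY un by (auto simp: P_def)
      then have "X = X \<union> Y" "Y = X \<union> Y" using XY by (auto simp: P_def)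
      then show False using XY by blast
    qed
  qed
  have cover: "\<Union>P = V"
  proof
    show "\<Union>P \<subseteq> V" by (auto simp: P_def T_def)
    show "V \<subseteq> \<Union>P"
    proof
      fix i assume "i \<in> V"
      then obtain Y where Y: "i \<in> Y" "Y \<subseteq> V" "sum r Y = h Y" using tight by blast
      then have "Y \<in> T" by (auto simp: T_def)
      then obtain Z where "Z \<in> T" "Y \<subseteq> Z" "\<forall>X\<in>T. Z \<subseteq> X \<longrightarrow> Z = X"
        using finite_has_maximal2[OF \<open>finite T\<close> \<open>Y \<in> T\<close>] by blast
      then show "i \<in> \<Union>P" using \<open>i \<in> Y\<close> by (auto simp: P_def)
    qed
  qed
  show part: "partition_on V P"
    using cover disj by (auto simp: partition_on_def P_def T_def)
  have "sum r V = (\<Sum>C\<in>P. sum r C)"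
    unfolding cover[symmetric] using disj assms(1)
    by (subst sum.Union_disjoint) (auto simp: disjoint_def P_def T_def finite_subset)
  also have "\<dots> = sum h P" by (intro sum.cong) (auto simp: P_def T_def)
  finally show "sum r V = sum h P" .
qed

section \<open>Partitions of the users and the bound \<open>phi\<close>\<close>

lemma sum_partition_on:
  fixes r :: "'v \<Rightarrow> real"
  assumes "finite V" "partition_on V P"
  shows "(\<Sum>C\<in>P. sum r C) = sum r V"
proof -
  have "sum r (\<Union>P) = (\<Sum>C\<in>P. sum r C)"
    using assms partition_onD1[OF assms(2)]
    by (subst sum.Union_disjoint)
       (auto simp: partition_on_def disjoint_def intro: finite_subset[of _ V])
  then show ?thesis using partition_onD1[OF assms(2)] by simp
qed

lemma finite_proper_partitions:
  assumes "finite V"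
  shows "finite (proper_partitions V)"
  by (rule finite_subset[of _ "Pow (Pow V)"]) (auto simp: proper_partitions_def partition_on_def assms)

text \<open>One user against the rest; this makes the maximum of \<open>phi\<close>
  meaningful.\<close>

lemma proper_partitions_nonempty:
  assumes "card V > 1"
  shows "proper_partitions V \<noteq> {}"
proof -
  obtain a where a: "a \<in> V" using assms by (metis all_not_in_conv card.empty not_less0)
  have "V - {a} \<noteq> {}" using assms by (metis Diff_eq_empty_iff card_mono card.empty card_insert_disjoint
    empty_iff finite.emptyI finite_insert leD One_nat_def)
  then have "partition_on V {{a}, V - {a}}" "card {{a}, V - {a}} = 2"
    using a by (auto simp: partition_on_def disjoint_def card_insert_if)
  then show ?thesis by (auto simp: proper_partitions_def)
qed

text \<open>Clearing the denominator \<bar>P\<bar> - 1 leaves \<bar>P\<bar> copies of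
  \<open>a\<close> on one side and one on the other. The right-hand form compares the target
  \<open>a\<close> with the sum of the bounds on the blocks, which is how both directions of the
  main argument meet \<open>phi\<close>.\<close>

lemma phi_le_iff:
  assumes "card P > 1"
  shows "phi H V P \<le> a \<longleftrightarrow> a \<le> (\<Sum>C\<in>P. H C + a - H V)"
proof -
  have fin: "finite P" using assms card.infinite by fastforce
  have pos: "real (card P) - 1 > 0" using assms by simp
  have "phi H V P = (\<Sum>C\<in>P. H V - H C) / (real (card P) - 1)"
    by (simp add: phi_def sum_divide_distrib)
  then have "phi H V P \<le> a \<longleftrightarrow> (\<Sum>C\<in>P. H V - H C) \<le> a * (real (card P) - 1)"
    using pos by (simp add: pos_divide_le_eq)
  moreover have "(\<Sum>C\<in>P. H C + a - H V) = a * real (card P) - (\<Sum>C\<in>P. H V - H C)"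
    by (simp add: sum_subtractf sum.distrib)
  ultimately show ?thesis by (auto simp: algebra_simps)
qed

text \<open>The constraint on the complement of a block, a proper subset because blocks are
  nonempty, bounds the rate of the block from above. Adding these bounds over the partition gives
  the claim.\<close>

lemma phi_le_sum_rate:
  assumes "finite V" "r \<in> R_CO H V" "P \<in> proper_partitions V"
  shows "phi H V P \<le> sum r V"
proof -
  have P: "partition_on V P" "card P > 1" using assms(3) by (auto simp: proper_partitions_def)
  have "sum r C \<le> H C + sum r V - H V" if "C \<in> P" for C
  proof -
    have C: "C \<subseteq> V" "C \<noteq> {}" using P(1) that by (auto simp: partition_on_def)
    then have "V - C \<subset> V" by blast
    then have "cond_ent H (V - C) (V - (V - C)) \<le> sum r (V - C)"
      using assms(2) unfolding R_CO_def by blast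
    moreover have "V - (V - C) = C" "V - C \<union> C = V" using C by auto
    moreover have "sum r (V - C) = sum r V - sum r C"
      using C(1) assms(1) by (simp add: sum_diff)
    ultimately show ?thesis by (simp add: cond_ent_def)
  qed
  then have "(\<Sum>C\<in>P. sum r C) \<le> (\<Sum>C\<in>P. H C + sum r V - H V)" by (rule sum_mono)
  then show ?thesis
    using sum_partition_on[OF assms(1) P(1)] phi_le_iff[OF P(2)] by auto
qed

text \<open>Every target above all values of \<open>phi\<close> is attained exactly; it is applied
  to the maximum itself and to its ceiling.\<close>

lemma exists_rate_with_sum:
  assumes "finite V" "V \<noteq> {}"
    and submod: "\<And>X Y. X \<subseteq> V \<Longrightarrow> Y \<subseteq> V \<Longrightarrow> X \<inter> Y \<noteq> {} \<Longrightarrow> H (X \<union> Y) + H (X \<inter> Y) \<le> H X + H Y"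
    and a: "\<And>P. P \<in> proper_partitions V \<Longrightarrow> phi H V P \<le> a"
  shows "\<exists>r \<in> R_CO H V. sum r V = a \<and> (integral_entropy H V \<longrightarrow> a \<in> \<int> \<longrightarrow> r \<in> R_CO_int H V)"
proof -
  \<comment> \<open>For total rate \<open>a\<close>, the lower bound on \<open>V - Y\<close> is the
    upper bound h(Y) on \<open>Y\<close>. At \<open>V\<close> itself the bound reads r(V) \<le>
    a.\<close>
  define h where "h Y = H Y + a - H V" for Y
  obtain r where feas: "\<And>Y. Y \<subseteq> V \<Longrightarrow> Y \<noteq> {} \<Longrightarrow> sum r Y \<le> h Y"
    and tight: "\<And>i. i \<in> V \<Longrightarrow> \<exists>Y. i \<in> Y \<and> Y \<subseteq> V \<and> sum r Y = h Y"
    and int: "(\<forall>Y. Y \<subseteq> V \<longrightarrow> h Y \<in> \<int>) \<longrightarrow> range r \<subseteq> \<int>"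
    using exists_tight_vector[OF assms(1), of h] by auto
  have "h (X \<union> Y) + h (X \<inter> Y) \<le> h X + h Y" if "X \<subseteq> V" "Y \<subseteq> V" "X \<inter> Y \<noteq> {}" for X Y
    using submod[OF that] by (simp add: h_def)
  then obtain P where P: "partition_on V P" "sum r V = sum h P"
    using tight_sets_partition[OF assms(1) _ feas tight] by blast
  have "a \<le> sum h P"
  proof (cases "card P > 1")
    case True
    then show ?thesis
      using a[of P] P(1) phi_le_iff[OF True, of H V a] by (simp add: proper_partitions_def h_def)
  next
    \<comment> \<open>The tight sets may form the one-block partition, for which \<open>phi\<close>
      has denominator 0; there the sum is h(V) = a directly.\<close>
    case False
    have "finite P" using P(1) assms(1) by (rule finite_elements[rotated])
    moreover have "P \<noteq> {}" using P(1) assms(2) by (auto simp: partition_on_def)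
    ultimately have "card P = 1" using False by (simp add: card_gt_0_iff order_antisym Suc_leI not_less)
    then obtain C where C: "P = {C}" by (auto simp: card_1_singleton_iff)
    then have "P = {V}" using partition_onD1[OF P(1)] by auto
    then show ?thesis by (simp add: h_def)
  qed
  then have rV: "sum r V = a" using P(2) feas[of V] assms(2) by (simp add: h_def)
  \<comment> \<open>Rate vectors must be \<open>undefined\<close> off \<open>V\<close>, which the
    greedy vector need not be.\<close>
  define s where "s = restrict r V"
  have sum_s: "sum s X = sum r X" if "X \<subseteq> V" for X
    using that by (intro sum.cong) (auto simp: s_def)
  have "cond_ent H X (V - X) \<le> sum s X" if "X \<subset> V" for X
  proof -
    have "sum r (V - X) \<le> h (V - X)" using that by (intro feas) auto
    moreover have "sum r (V - X) = a - sum r X" using that assms(1) rV by (simp add: sum_diff psubset_imp_subset)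
    moreover have "X \<union> (V - X) = V" using that by auto
    ultimately show ?thesis using that sum_s[of X] by (simp add: cond_ent_def h_def)
  qed
  then have "s \<in> R_CO H V" by (auto simp: R_CO_def s_def)
  moreover have "s \<in> V \<rightarrow>\<^sub>E \<int>" if "integral_entropy H V" "a \<in> \<int>"
  proof -
    have "\<forall>Y. Y \<subseteq> V \<longrightarrow> h Y \<in> \<int>"
      using that by (auto simp: h_def integral_entropy_def)
    then show ?thesis using int by (auto simp: s_def)
  qed
  ultimately show ?thesis using sum_s[of V] rV by (auto simp: R_CO_int_def)
qed

text \<open>A constant integral vector exceeding every conditional entropy in absolute value
  satisfies each constraint on a nonempty set; the empty set asks only 0 \<le> 0.\<close>

lemma R_CO_int_nonempty:
  assumes "finite V"
  shows "R_CO_int H V \<noteq> {}"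
proof -
  define N where "N = (\<Sum>Y\<in>Pow V. of_int \<lceil>\<bar>H V - H Y\<bar>\<rceil> :: real)"
  have "cond_ent H X (V - X) \<le> (\<Sum>i\<in>X. if i \<in> V then N else undefined)" if "X \<subset> V" for X
  proof (cases "X = {}")
    case True
    then show ?thesis by (simp add: cond_ent_def)
  next
    case False
    have "\<bar>H V - H (V - X)\<bar> \<le> of_int \<lceil>\<bar>H V - H (V - X)\<bar>\<rceil>" by simp
    also have "\<dots> \<le> N"
      unfolding N_def using assms that
      by (intro member_le_sum) (auto intro: order_trans[of _ "\<bar>_\<bar>"])
    finally have N: "\<bar>H V - H (V - X)\<bar> \<le> N" .
    have "1 \<le> real (card X)"
      using that False assms finite_subset[of X V] by (simp add: Suc_leI card_gt_0_iff psubset_imp_subset)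
    then have "1 * N \<le> real (card X) * N"
      using N by (intro mult_right_mono) auto
    moreover have "(\<Sum>i\<in>X. if i \<in> V then N else undefined) = (\<Sum>i\<in>X. N)"
      using that by (intro sum.cong) auto
    moreover have "X \<union> (V - X) = V" using that by auto
    ultimately show ?thesis using N by (simp add: cond_ent_def)
  qed
  moreover have "N \<in> \<int>" by (auto simp: N_def)
  ultimately have "(\<lambda>i\<in>V. N) \<in> R_CO_int H V"
    by (auto simp: R_CO_int_def R_CO_def restrict_def)
  then show ?thesis by blast
qed

text \<open>Integral sum-rates are integers bounded below by any value of \<open>phi\<close>, so
  well-ordering yields a minimum. This covers non-integral \<open>H\<close> too, where no ceiling
  formula is claimed.\<close>

lemma exists_min_R_CO_int:
  assumes "finite V" "card V > 1"
  shows "\<exists>r. is_arg_min (\<lambda>r. sum r V) (\<lambda>r. r \<in> R_CO_int H V) r"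
proof -
  obtain P where P: "P \<in> proper_partitions V" using proper_partitions_nonempty[OF assms(2)] by blast
  let ?B = "\<lfloor>phi H V P\<rfloor>"
  \<comment> \<open>The height of the sum-rate above the integer lower bound \<open>?B\<close>; on
    \<open>R_CO_int H V\<close> the difference is nonnegative, so \<open>nat\<close> loses
    nothing.\<close>
  define m where "m r = nat (\<lfloor>sum r V\<rfloor> - ?B)" for r :: "'a \<Rightarrow> real"
  obtain r0 where "r0 \<in> R_CO_int H V" using R_CO_int_nonempty[OF assms(1)] by blast
  then obtain r where r: "r \<in> R_CO_int H V" "\<And>s. s \<in> R_CO_int H V \<Longrightarrow> m r \<le> m s"
    using ex_has_least_nat[of "\<lambda>r. r \<in> R_CO_int H V" r0 m] by blast
  have sum_eq: "sum s V = of_int (?B + int (m s))" if "s \<in> R_CO_int H V" for s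
  proof -
    have "sum s V \<in> \<int>" using that by (intro Ints_sum) (auto simp: R_CO_int_def)
    moreover have "?B \<le> \<lfloor>sum s V\<rfloor>"
      using that phi_le_sum_rate[OF assms(1) _ P] by (intro floor_mono) (auto simp: R_CO_int_def)
    ultimately show ?thesis by (simp add: m_def)
  qed
  have "is_arg_min (\<lambda>r. sum r V) (\<lambda>r. r \<in> R_CO_int H V) r"
    using r by (auto simp: is_arg_min_def sum_eq not_less)
  then show ?thesis by blast
qed

text \<open>Each \<open>phi\<close> value is a lower bound, and \<open>exists_rate_with_sum\<close>
  attains the maximum, or its ceiling in the integral case. Entropy enters only through
  submodularity on intersecting pairs.\<close>

lemma min_sum_rates:
  assumes "finite V" "card V > 1"
    and submod: "\<And>X Y. X \<subseteq> V \<Longrightarrow> Y \<subseteq> V \<Longrightarrow> X \<inter> Y \<noteq> {} \<Longrightarrow> H (X \<union> Y) + H (X \<inter> Y) \<le> H X + H Y"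
  defines "\<mu> \<equiv> Max (phi H V ` proper_partitions V)"
  shows "\<exists>r. is_arg_min (\<lambda>r. sum r V) (\<lambda>r. r \<in> R_CO H V) r"
    and "R_ACO H V = \<mu>"
    and "integral_entropy H V \<Longrightarrow> R_NCO H V = of_int \<lceil>\<mu>\<rceil>"
proof -
  have V: "V \<noteq> {}" using assms(2) by auto
  have fin: "finite (phi H V ` proper_partitions V)"
    using finite_proper_partitions[OF assms(1)] by simp
  have ne: "phi H V ` proper_partitions V \<noteq> {}"
    using proper_partitions_nonempty[OF assms(2)] by simp
  have phi_le: "phi H V P \<le> \<mu>" if "P \<in> proper_partitions V" for P
    unfolding \<mu>_def using fin that by (intro Max_ge) auto
  have lower: "\<mu> \<le> sum r V" if "r \<in> R_CO H V" for r
    unfolding \<mu>_def using fin ne phi_le_sum_rate[OF assms(1) that] by (subst Max_le_iff) auto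
  obtain r where r: "r \<in> R_CO H V" "sum r V = \<mu>"
    using exists_rate_with_sum[OF assms(1) V submod phi_le] by blast
  then show "\<exists>r. is_arg_min (\<lambda>r. sum r V) (\<lambda>r. r \<in> R_CO H V) r"
    using lower by (auto simp: is_arg_min_def not_less)
  show "R_ACO H V = \<mu>"
    unfolding R_ACO_def using r lower by (intro Least_equality) auto
  assume H: "integral_entropy H V"
  have "phi H V P \<le> of_int \<lceil>\<mu>\<rceil>" if "P \<in> proper_partitions V" for P
    using phi_le[OF that] le_of_int_ceiling order_trans by blast
  then obtain s where s: "s \<in> R_CO_int H V" "sum s V = of_int \<lceil>\<mu>\<rceil>"
    using exists_rate_with_sum[OF assms(1) V submod, where a = "of_int \<lceil>\<mu>\<rceil>"] H by auto
  have "of_int \<lceil>\<mu>\<rceil> \<le> sum t V" if t: "t \<in> R_CO_int H V" for t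
  proof -
    have "sum t V \<in> \<int>" using t by (intro Ints_sum) (auto simp: R_CO_int_def)
    then obtain k where k: "sum t V = of_int k" by (auto elim: Ints_cases)
    have "\<mu> \<le> sum t V" using t lower by (auto simp: R_CO_int_def)
    then have "\<lceil>\<mu>\<rceil> \<le> k" unfolding k by (rule ceiling_le)
    then show ?thesis using k by simp
  qed
  then show "R_NCO H V = of_int \<lceil>\<mu>\<rceil>"
    unfolding R_NCO_def using s by (intro Least_equality) (auto intro!: image_eqI[of _ _ s])
qed

theorem mainTheorem1:
  fixes M :: "'w measure" and b :: real
    and V :: "'v set" and Z :: "'v \<Rightarrow> 'w \<Rightarrow> 'a" and H :: "'v set \<Rightarrow> real"
  assumes "information_space M b"
    and "finite V" and "card V > 1"
    and "discrete_source M b Z V"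
    and "H = source_entropy M b Z"
  shows "(\<exists>r. is_arg_min (\<lambda>r. sum r V) (\<lambda>r. r \<in> R_CO H V) r) \<and>
         R_ACO H V = Max (phi H V ` proper_partitions V) \<and>
         (\<exists>r. is_arg_min (\<lambda>r. sum r V) (\<lambda>r. r \<in> R_CO_int H V) r) \<and>
         (integral_entropy H V \<longrightarrow>
            R_NCO H V = of_int \<lceil>Max (phi H V ` proper_partitions V)\<rceil>)"
proof -
  have submod: "H (X \<union> Y) + H (X \<inter> Y) \<le> H X + H Y" if "X \<subseteq> V" "Y \<subseteq> V" for X Y
    unfolding assms(5)
    by (rule information_space.source_entropy_submodular[OF assms(1,2,4) that])
  show ?thesis
    using min_sum_rates[OF assms(2,3) submod] exists_min_R_CO_int[OF assms(2,3)] by blast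
qed

end
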